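(* Let $p$ be an odd prime, $s\ge 2$ and $m\ge 1$ integers, $R$ the Galois ring of characteristic $p^{s}$ and cardinality $p^{sm}$, $\nu\ge 1$ an integer and $\delta\in\{0,1,2\}$. Then the orthogonal graph $\Gamma^{2\nu+\delta}$ over $R$ is arc transitive; more precisely, the orthogonal group $\mathrm{O}_{2\nu+\delta}(R)$ acts transitively on the vertices of $\Gamma^{2\nu+\delta}$ and on the ordered pairs of adjacent vertices.
   Context: $R$ is a finite local ring with maximal ideal $pR$ and residue field $R/pR$ of order $p^{m}$; $R^{*}$ denotes its unit group, and $z$ is a fixed element of $R^{*}$ that is not a square in $R$. Let $R^{2\nu+\delta}$ be the set of row vectors $(a_1,\dots,a_{2\nu+\delta})$ over $R$ with at least one coordinate in $R^{*}$; two such vectors are equivalent if one is a unit multiple of the other, and $[a_1,\dots,a_{2\nu+\delta}]$ denotes the equivalence class. $e_i$ is the vector with $1$ in position $i$ and $0$ elsewhere. Let $S=S_{2\nu+\delta,\Delta}=\begin{pmatrix}0&I^{(\nu)}&0\\ I^{(\nu)}&0&0\\0&0&\Delta\end{pmatrix}$, where $\Delta$ is absent if $\delta=0$, $\Delta=(1)$ or $\Delta=(z)$ (one fixed choice) if $\delta=1$, and $\Delta=\mathrm{diag}(1,-z)$ if $\delta=2$. The orthogonal graph $\Gamma^{2\nu+\delta}$ has vertex set $\{[\alpha]:\alpha S\alpha^{t}=0\}$, with $[\alpha]$ and $[\beta]$ adjacent iff $\alpha S\beta^{t}\in R^{*}$. The orthogonal group $\mathrm{O}_{2\nu+\delta}(R)$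 is the set of $(2\nu+\delta)\times(2\nu+\delta)$ matrices $T$ over $R$ with $TST^{t}=S$; it acts on vertices by $[\alpha]\mapsto[\alpha T]$ as graph automorphisms. The paper's standing assumption is $s\ge 2$. *)

theory Defs
  imports
    "HOL-Computational_Algebra.Primes"
    "HOL-Algebra.Group_Action"
    "Jordan_Normal_Form.Matrix"
    "Graph_Theory.Pair_Digraph"
begin

text \<open>
  A Galois ring is a finite commutative ring with identity whose zero divisors, together
  with 0, form the principal ideal generated by \<open>p \<cdot> 1\<close> for some prime \<open>p\<close>; it is
  determined up to isomorphism by its characteristic \<open>p ^ s\<close> and its cardinality
  \<open>p ^ (s * m)\<close>. As \<open>1 \<noteq> 0\<close>, the set of zero divisors below contains 0. Finiteness
  is implied by the positive cardinality. The lemma \<open>galois_ring_nonunits\<close> shows that such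
  a ring is local with maximal ideal \<open>pR\<close>.
\<close>
definition galois_ring :: "'a::comm_ring_1 itself \<Rightarrow> nat \<Rightarrow> nat \<Rightarrow> nat \<Rightarrow> bool" where
  "galois_ring R p s m \<longleftrightarrow>
     prime p \<and> CHAR('a) = p ^ s \<and> card (UNIV :: 'a set) = p ^ (s * m) \<and>
     {x :: 'a. \<exists>y. y \<noteq> 0 \<and> x * y = 0} = range (\<lambda>r. of_nat p * r)"

lemma galois_ring_nonunits:
  assumes "galois_ring TYPE('a::comm_ring_1) p s m"
  shows "{x :: 'a. \<not> x dvd 1} = range (\<lambda>r. of_nat p * r)"
proof -
  have p: "prime p" and c: "card (UNIV :: 'a set) = p ^ (s * m)"
    using assms by (simp_all add: galois_ring_def)
  have fin: "finite (UNIV :: 'a set)"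
    using p c by (metis card.infinite power_not_zero not_prime_0)
  have "\<not> x dvd 1 \<longleftrightarrow> (\<exists>y. y \<noteq> 0 \<and> x * y = 0)" for x :: 'a
  proof
    assume n: "\<not> x dvd 1"
    have "\<not> surj ((*) x)"
      using n by (metis dvdI surjD)
    then have "\<not> inj ((*) x)"
      using fin finite_UNIV_inj_surj by blast
    then obtain a b where "x * a = x * b" "a \<noteq> b"
      by (auto simp: inj_def)
    then have "a - b \<noteq> 0 \<and> x * (a - b) = 0"
      by (simp add: algebra_simps)
    then show "\<exists>y. y \<noteq> 0 \<and> x * y = 0" by blast
  next
    assume "\<exists>y. y \<noteq> 0 \<and> x * y = 0"
    then obtain y where y: "y \<noteq> 0" "x * y = 0" by blast
    show "\<not> x dvd 1"
    proof
      assume "x dvd 1"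
      then obtain u where "1 = x * u" by (auto elim: dvdE)
      then have "y = (x * y) * u"
        by (metis mult.assoc mult.commute mult.right_neutral)
      then show False using y by simp
    qed
  qed
  then show ?thesis using assms by (simp add: galois_ring_def)
qed

definition unimodular_vecs :: "nat \<Rightarrow> 'a::comm_ring_1 vec set" where
  "unimodular_vecs n = {\<alpha> \<in> carrier_vec n. \<exists>i<n. \<alpha> $ i dvd 1}"

definition unit_class :: "'a::comm_ring_1 vec \<Rightarrow> 'a vec set" where
  "unit_class \<alpha> = {u \<cdot>\<^sub>v \<alpha> | u. u dvd 1}"

definition Delta_blocks :: "'a::comm_ring_1 \<Rightarrow> nat \<Rightarrow> 'a mat set" where
  "Delta_blocks z \<delta> =
     (if \<delta> = 0 then {0\<^sub>m 0 0}
      else if \<delta> = 1 then {mat_of_rows_list 1 [[1]], mat_of_rows_list 1 [[z]]}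
      else if \<delta> = 2 then {mat_of_rows_list 2 [[1, 0], [0, - z]]}
      else {})"

definition S_mat :: "nat \<Rightarrow> nat \<Rightarrow> 'a::comm_ring_1 mat \<Rightarrow> 'a mat" where
  "S_mat \<nu> \<delta> \<Delta> =
     four_block_mat
       (four_block_mat (0\<^sub>m \<nu> \<nu>) (1\<^sub>m \<nu>) (1\<^sub>m \<nu>) (0\<^sub>m \<nu> \<nu>)) (0\<^sub>m (2 * \<nu>) \<delta>)
       (0\<^sub>m \<delta> (2 * \<nu>)) \<Delta>"

text \<open>The scalar \<open>\<alpha> S \<beta>\<^sup>t\<close> for row vectors \<open>\<alpha>\<close>, \<open>\<beta>\<close>.\<close>
definition bil :: "'a::comm_ring_1 mat \<Rightarrow> 'a vec \<Rightarrow> 'a vec \<Rightarrow> 'a" where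
  "bil S \<alpha> \<beta> = \<alpha> \<bullet> (S *\<^sub>v \<beta>)"

definition orth_graph :: "nat \<Rightarrow> nat \<Rightarrow> 'a::comm_ring_1 mat \<Rightarrow> 'a vec set pair_pre_digraph" where
  "orth_graph \<nu> \<delta> \<Delta> =
     (let S = S_mat \<nu> \<delta> \<Delta>; I = {\<alpha> \<in> unimodular_vecs (2 * \<nu> + \<delta>). bil S \<alpha> \<alpha> = 0}
      in \<lparr> pverts = unit_class ` I,
           parcs = {(unit_class \<alpha>, unit_class \<beta>) | \<alpha> \<beta>. \<alpha> \<in> I \<and> \<beta> \<in> I \<and> bil S \<alpha> \<beta> dvd 1} \<rparr>)"

definition orth_group :: "nat \<Rightarrow> nat \<Rightarrow> 'a::comm_ring_1 mat \<Rightarrow> 'a mat monoid" where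
  "orth_group \<nu> \<delta> \<Delta> =
     \<lparr> carrier = {T \<in> carrier_mat (2 * \<nu> + \<delta>) (2 * \<nu> + \<delta>).
                   T * S_mat \<nu> \<delta> \<Delta> * T\<^sup>T = S_mat \<nu> \<delta> \<Delta>},
       monoid.mult = (*), one = 1\<^sub>m (2 * \<nu> + \<delta>) \<rparr>"

text \<open>
  The row vector \<open>\<alpha> T\<close> is \<open>T\<^sup>T *\<^sub>v \<alpha>\<close>, so \<open>[\<alpha>] \<mapsto> [\<alpha> T]\<close> is the image of the
  class under this map, see \<open>vertex_act_unit_class\<close>.
\<close>
definition vertex_act :: "'a::comm_ring_1 mat \<Rightarrow> 'a vec set \<Rightarrow> 'a vec set" where
  "vertex_act T X = (\<lambda>\<alpha>. T\<^sup>T *\<^sub>v \<alpha>) ` X"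

lemma vertex_act_unit_class:
  assumes "T \<in> carrier_mat n n" "\<alpha> \<in> carrier_vec n"
  shows "vertex_act T (unit_class \<alpha>) = unit_class (T\<^sup>T *\<^sub>v \<alpha>)"
proof -
  have "T\<^sup>T *\<^sub>v (u \<cdot>\<^sub>v \<alpha>) = u \<cdot>\<^sub>v (T\<^sup>T *\<^sub>v \<alpha>)" for u
    using assms by (intro eq_vecI) (auto simp: scalar_prod_def sum_distrib_left ac_simps)
  then show ?thesis
    by (simp add: vertex_act_def unit_class_def setcompr_eq_image image_image)
qed

text \<open>
  Group actions in the library are left actions. The orthogonal group acts from the right,
  and a right action of a group is a left action of the opposite group. The restriction is
  needed because the bijections in \<^const>\<open>BijGroup\<close> are extensional functions.
\<close>
definition opposite_group :: "('g, 'm) monoid_scheme \<Rightarrow> 'g monoid" where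
  "opposite_group G =
     \<lparr> carrier = carrier G, monoid.mult = (\<lambda>x y. y \<otimes>\<^bsub>G\<^esub> x), one = \<one>\<^bsub>G\<^esub> \<rparr>"

definition acts_transitively_right ::
    "('g, 'm) monoid_scheme \<Rightarrow> ('g \<Rightarrow> 'x \<Rightarrow> 'x) \<Rightarrow> 'x set \<Rightarrow> bool" where
  "acts_transitively_right G act E \<longleftrightarrow>
     transitive_action (opposite_group G) E (\<lambda>g. restrict (act g) E)"

definition graph_automorphism :: "'v pair_pre_digraph \<Rightarrow> ('v \<Rightarrow> 'v) \<Rightarrow> bool" where
  "graph_automorphism G f \<longleftrightarrow>
     bij_betw f (pverts G) (pverts G) \<and>
     (\<forall>x\<in>pverts G. \<forall>y\<in>pverts G. (x, y) \<in> parcs G \<longleftrightarrow> (f x, f y) \<in> parcs G)"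

definition arc_transitive :: "'v pair_pre_digraph \<Rightarrow> bool" where
  "arc_transitive G \<longleftrightarrow>
     (\<forall>(a, b) \<in> parcs G. \<forall>(c, d) \<in> parcs G. \<exists>f. graph_automorphism G f \<and> f a = c \<and> f b = d)"

end

theory Submission
  imports Defs "Jordan_Normal_Form.Determinant"
begin

text \<open>
  Write \<open>B\<close> for the bilinear form of \<open>S\<close>. If \<open>x\<close>, \<open>y\<close> are isotropic and \<open>B(x,y)\<close> is a unit, then
  \<open>B(x-y,x-y) = -2 B(x,y)\<close> is a unit and the reflection in \<open>x - y\<close> maps \<open>x\<close> to \<open>y\<close>. As any two
  isotropic unimodular vectors are joined by a path of length at most 3 in the graph, the orthogonal
  group is transitive on isotropic unimodular vectors. If \<open>B(x,y) = B(x,y') = 1\<close> for isotropic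
  \<open>x\<close>, \<open>y\<close>, \<open>y'\<close>, then the Eichler transformation
  \<open>v \<mapsto> v + B(v,x)u - B(v,u)x - (1/2)B(u,u)B(v,x)x\<close> with \<open>u = y' - y\<close> fixes \<open>x\<close> and maps
  \<open>y\<close> to \<open>y'\<close>, so the stabiliser of a vertex is transitive on its neighbours.
\<close>

section \<open>Matrices and right actions\<close>

lemma mult_mat_vec_smult:
  fixes A :: "'a::comm_ring_1 mat"
  assumes "A \<in> carrier_mat n k" "v \<in> carrier_vec k"
  shows "A *\<^sub>v (c \<cdot>\<^sub>v v) = c \<cdot>\<^sub>v (A *\<^sub>v v)"
  using assms by (intro eq_vecI) auto

text \<open>Determinants over a commutative ring decide this: \<open>det A\<close> has the inverse
  \<open>det C\<close>, so the adjugate scaled by \<open>det C\<close> is a left inverse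
  \<open>L\<close> of \<open>A\<close>, and \<open>L = L * (A * C) = C\<close>.\<close>

lemma right_inverse_mat_imp_left_inverse:
  fixes A C :: "'a::comm_ring_1 mat"
  assumes A: "A \<in> carrier_mat n n" and C: "C \<in> carrier_mat n n" and AC: "A * C = 1\<^sub>m n"
  shows "C * A = 1\<^sub>m n"
proof -
  have d: "det C * det A = 1"
    using det_mult[OF A C] AC by (simp add: mult.commute)
  define L where "L = det C \<cdot>\<^sub>m adj_mat A"
  have L: "L \<in> carrier_mat n n"
    using adj_mat(1)[OF A] by (simp add: L_def)
  have LA: "L * A = 1\<^sub>m n"
    using adj_mat[OF A] A d
    by (simp add: L_def mult_smult_assoc_mat[of _ n n _ n]) (intro eq_matI, auto)
  have "L = L * (A * C)" using L AC by simp
  also have "\<dots> = (L * A) * C" using L A C by simp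
  also have "\<dots> = C" using LA C by simp
  finally show ?thesis using LA by simp
qed

text \<open>Unit vectors read off the entries. This turns preservation of the form into the matrix
  identity that defines the orthogonal group.\<close>

lemma mat_eqI_scalar_prod:
  fixes A C :: "'a::comm_ring_1 mat"
  assumes A: "A \<in> carrier_mat n k" and C: "C \<in> carrier_mat n k"
    and eq: "\<And>v w. v \<in> carrier_vec n \<Longrightarrow> w \<in> carrier_vec k \<Longrightarrow> v \<bullet> (A *\<^sub>v w) = v \<bullet> (C *\<^sub>v w)"
  shows "A = C"
proof (rule eq_matI)
  fix i j assume "i < dim_row C" "j < dim_col C"
  then have i: "i < n" and j: "j < k" using C by auto
  show "A $$ (i, j) = C $$ (i, j)"
    using eq[of "unit_vec n i" "unit_vec k j"] i j A C by simp
qed (use A C in auto)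

text \<open>Column times row. With \<open>c = S *\<^sub>v d\<close> it represents the map taking v
  to B(v,d) a for symmetric \<open>S\<close>, the building block of reflections and Eichler
  transformations.\<close>

definition outer_prod :: "'a::comm_ring_1 vec \<Rightarrow> 'a vec \<Rightarrow> 'a mat" where
  "outer_prod a c = mat (dim_vec a) (dim_vec c) (\<lambda>(i, j). a $ i * c $ j)"

lemma outer_prod_carrier:
  "a \<in> carrier_vec n \<Longrightarrow> c \<in> carrier_vec k \<Longrightarrow> outer_prod a c \<in> carrier_mat n k"
  by (auto simp: outer_prod_def)

lemma outer_prod_mult_vec:
  assumes "a \<in> carrier_vec n" "c \<in> carrier_vec k" "v \<in> carrier_vec k"
  shows "outer_prod a c *\<^sub>v v = (c \<bullet> v) \<cdot>\<^sub>v a"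
  using assms
  by (intro eq_vecI) (auto simp: outer_prod_def scalar_prod_def sum_distrib_left sum_distrib_right ac_simps)

section \<open>Unit classes and transitive right actions\<close>

lemma unit_class_smult:
  assumes u: "u dvd (1::'a::comm_ring_1)"
  shows "unit_class (u \<cdot>\<^sub>v \<alpha>) = unit_class \<alpha>"
proof -
  obtain u' where u': "1 = u * u'" using u by (auto elim: dvdE)
  have "\<exists>w'. w' dvd 1 \<and> w \<cdot>\<^sub>v (u \<cdot>\<^sub>v \<alpha>) = w' \<cdot>\<^sub>v \<alpha>" if "w dvd 1" for w
    using that u by (intro exI[of _ "w * u"]) (simp add: smult_smult_assoc is_unit_mult_iff)
  moreover have "\<exists>w'. w' dvd 1 \<and> w \<cdot>\<^sub>v \<alpha> = w' \<cdot>\<^sub>v (u \<cdot>\<^sub>v \<alpha>)" if "w dvd 1" for w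
  proof (intro exI[of _ "w * u'"] conjI)
    have "u' dvd 1" using u' by (metis dvd_triv_right)
    then show "w * u' dvd 1" using that by (simp add: is_unit_mult_iff)
    have "w * u' * u = w" using u' by (metis mult.assoc mult.commute mult.right_neutral)
    then show "w \<cdot>\<^sub>v \<alpha> = (w * u') \<cdot>\<^sub>v (u \<cdot>\<^sub>v \<alpha>)" by (simp add: smult_smult_assoc)
  qed
  ultimately show ?thesis unfolding unit_class_def by blast
qed

text \<open>Bijectivity of each \<open>act g\<close> on \<open>E\<close> follows from the action
  laws, which make the action of the inverse of \<open>g\<close> a two-sided inverse map.\<close>

lemma acts_transitively_rightI:
  assumes G: "group G"
    and closed: "\<And>g x. g \<in> carrier G \<Longrightarrow> x \<in> E \<Longrightarrow> act g x \<in> E"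
    and one: "\<And>x. x \<in> E \<Longrightarrow> act \<one>\<^bsub>G\<^esub> x = x"
    and mult: "\<And>g h x. g \<in> carrier G \<Longrightarrow> h \<in> carrier G \<Longrightarrow> x \<in> E \<Longrightarrow>
      act (g \<otimes>\<^bsub>G\<^esub> h) x = act h (act g x)"
    and trans: "\<And>x y. x \<in> E \<Longrightarrow> y \<in> E \<Longrightarrow> \<exists>g\<in>carrier G. act g x = y"
  shows "acts_transitively_right G act E"
proof -
  interpret G: group G by (fact G)
  have op: "group (opposite_group G)"
  proof (rule groupI)
    fix x assume "x \<in> carrier (opposite_group G)"
    then show "\<exists>y\<in>carrier (opposite_group G). y \<otimes>\<^bsub>opposite_group G\<^esub> x = \<one>\<^bsub>opposite_group G\<^esub>"
      by (intro bexI[of _ "inv\<^bsub>G\<^esub> x"]) (auto simp: opposite_group_def)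
  qed (auto simp: opposite_group_def G.m_assoc)
  have bij: "restrict (act g) E \<in> Bij E" if g: "g \<in> carrier G" for g
  proof -
    have "bij_betw (act g) E E"
    proof (rule bij_betw_byWitness[where f' = "act (inv\<^bsub>G\<^esub> g)"])
      show "\<forall>x\<in>E. act (inv\<^bsub>G\<^esub> g) (act g x) = x"
        using mult[of g "inv\<^bsub>G\<^esub> g"] g one by simp
      show "\<forall>x\<in>E. act g (act (inv\<^bsub>G\<^esub> g) x) = x"
        using mult[of "inv\<^bsub>G\<^esub> g" g] g one by simp
    qed (use closed g in auto)
    then show ?thesis by (simp add: Bij_def bij_betw_restrict_eq)
  qed
  \<comment> \<open>In the opposite group the product of \<open>g\<close> and \<open>h\<close> is h
    \<otimes> g, which acts by \<open>h\<close> first and then by \<open>g\<close>; this is the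
    order of composition in \<open>BijGroup E\<close>.\<close>
  have "restrict (act (h \<otimes>\<^bsub>G\<^esub> g)) E = compose E (restrict (act g) E) (restrict (act h) E)"
    if "g \<in> carrier G" "h \<in> carrier G" for g h
    using that closed mult by (auto simp: compose_def fun_eq_iff)
  then have "(\<lambda>g. restrict (act g) E) \<in> hom (opposite_group G) (BijGroup E)"
    using bij by (auto simp: hom_def BijGroup_def opposite_group_def)
  then have "group_hom (opposite_group G) (BijGroup E) (\<lambda>g. restrict (act g) E)"
    using op group_BijGroup by (simp add: group_hom_def group_hom_axioms_def)
  then show ?thesis
    unfolding acts_transitively_right_def
    using trans
    by (simp add: transitive_action_def transitive_action_axioms_def group_action_def opposite_group_def)
qed

section \<open>Symmetric bilinear spaces over a local ring\<close>

text \<open>What the transitivity proof takes from the Galois ring and from \<open>S_mat\<close>: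
  \<open>nonunit_add\<close> expresses that the ring is local, \<open>S_inv\<close> that the form is
  nondegenerate, and \<open>two_unit\<close> allows halving when a vector is corrected to an
  isotropic one.\<close>

locale local_bilinear_space =
  fixes n :: nat and S :: "'a::comm_ring_1 mat"
  assumes S: "S \<in> carrier_mat n n"
    and S_sym: "S\<^sup>T = S"
    and S_inv: "\<exists>S' \<in> carrier_mat n n. S * S' = 1\<^sub>m n"
    and two_unit: "(2::'a) dvd 1"
    and nonunit_add: "\<And>a b :: 'a. \<not> a dvd 1 \<Longrightarrow> \<not> b dvd 1 \<Longrightarrow> \<not> (a + b) dvd 1"
begin

abbreviation B :: "'a vec \<Rightarrow> 'a vec \<Rightarrow> 'a" where "B \<equiv> bil S"

definition isotropic :: "'a vec set" where
  "isotropic = {\<alpha> \<in> unimodular_vecs n. B \<alpha> \<alpha> = 0}"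

text \<open>The orthogonal group in terms of column vectors: the row action of \<open>T\<close> is
  multiplication by \<open>T\<^sup>T\<close>, so \<open>M\<close> stands for a transposed group
  element.\<close>

definition isometry :: "'a mat \<Rightarrow> bool" where
  "isometry M \<longleftrightarrow> M \<in> carrier_mat n n \<and>
     (\<forall>v\<in>carrier_vec n. \<forall>w\<in>carrier_vec n. B (M *\<^sub>v v) (M *\<^sub>v w) = B v w)"

lemma B_sym: "v \<in> carrier_vec n \<Longrightarrow> w \<in> carrier_vec n \<Longrightarrow> B v w = B w v"
  using transpose_vec_mult_scalar[OF S, of w v] S S_sym
  by (simp add: bil_def comm_scalar_prod[of "S *\<^sub>v v" n w])

lemma B_add_left:
  "u \<in> carrier_vec n \<Longrightarrow> v \<in> carrier_vec n \<Longrightarrow> w \<in> carrier_vec n \<Longrightarrow> B (u + v) w = B u w + B v w"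
  using S by (simp add: bil_def add_scalar_prod_distrib[of _ n])

lemma B_add_right:
  "u \<in> carrier_vec n \<Longrightarrow> v \<in> carrier_vec n \<Longrightarrow> w \<in> carrier_vec n \<Longrightarrow> B w (u + v) = B w u + B w v"
  using B_add_left[of u v w] by (simp add: B_sym[of w])

lemma B_smult_left: "u \<in> carrier_vec n \<Longrightarrow> w \<in> carrier_vec n \<Longrightarrow> B (c \<cdot>\<^sub>v u) w = c * B u w"
  using S by (simp add: bil_def)

lemma B_smult_right: "u \<in> carrier_vec n \<Longrightarrow> w \<in> carrier_vec n \<Longrightarrow> B w (c \<cdot>\<^sub>v u) = c * B w u"
  using B_smult_left[of u w c] by (simp add: B_sym[of w])

lemma B_diff_left:
  "u \<in> carrier_vec n \<Longrightarrow> v \<in> carrier_vec n \<Longrightarrow> w \<in> carrier_vec n \<Longrightarrow> B (u - v) w = B u w - B v w"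
  using S by (simp add: bil_def minus_scalar_prod_distrib[of _ n])

lemma B_diff_right:
  "u \<in> carrier_vec n \<Longrightarrow> v \<in> carrier_vec n \<Longrightarrow> w \<in> carrier_vec n \<Longrightarrow> B w (u - v) = B w u - B w v"
  using B_diff_left[of u v w] by (simp add: B_sym[of w])

lemmas B_simps = B_add_left B_add_right B_smult_left B_smult_right B_diff_left B_diff_right

section \<open>Isotropic and unimodular vectors\<close>

lemma isotropic_carrier: "x \<in> isotropic \<Longrightarrow> x \<in> carrier_vec n"
  by (simp add: isotropic_def unimodular_vecs_def)

lemma isotropic_null: "x \<in> isotropic \<Longrightarrow> B x x = 0"
  by (simp add: isotropic_def)

lemma unit_sum_imp_unit_summand:
  fixes f :: "'b \<Rightarrow> 'a"
  assumes "finite A" "sum f A dvd 1"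
  shows "\<exists>i\<in>A. f i dvd 1"
  using assms
proof (induction A rule: finite_induct)
  case empty
  then show ?case by simp
next
  case (insert a A)
  then show ?case using nonunit_add[of "f a" "sum f A"] by auto
qed

text \<open>\<open>B x v\<close> is a linear combination of the coordinates of \<open>x\<close>, so
  by locality one summand, and then its coordinate, is a unit. Together with the converse below this
  describes unimodularity through the form alone, which isometries preserve.\<close>

lemma unit_B_imp_unimodular:
  assumes "x \<in> carrier_vec n" "v \<in> carrier_vec n" "B x v dvd 1"
  shows "x \<in> unimodular_vecs n"
proof -
  have "(\<Sum>i\<in>{0..<n}. x $ i * (S *\<^sub>v v) $ i) dvd 1"
    using assms S by (simp add: bil_def scalar_prod_def)
  then obtain i where "i < n" "x $ i * (S *\<^sub>v v) $ i dvd 1"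
    using unit_sum_imp_unit_summand[of "{0..<n}"] by fastforce
  then show ?thesis
    using assms by (auto simp: unimodular_vecs_def is_unit_mult_iff)
qed

text \<open>Invertibility of \<open>S\<close> provides \<open>v\<close> with
  \<open>S *\<^sub>v v\<close> a unit vector, so \<open>B x v\<close> can be made equal to any
  prescribed coordinate of \<open>x\<close>.\<close>

lemma unimodular_imp_unit_B:
  assumes "x \<in> unimodular_vecs n"
  shows "\<exists>v\<in>carrier_vec n. B x v dvd 1"
proof -
  obtain S' where S': "S' \<in> carrier_mat n n" "S * S' = 1\<^sub>m n" using S_inv by blast
  obtain i where x: "x \<in> carrier_vec n" and i: "i < n" "x $ i dvd 1"
    using assms by (auto simp: unimodular_vecs_def)
  have "S *\<^sub>v (S' *\<^sub>v unit_vec n i) = unit_vec n i"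
    using S' S by (metis assoc_mult_mat_vec one_mult_mat_vec unit_vec_carrier)
  then have "B x (S' *\<^sub>v unit_vec n i) = x $ i"
    using i x by (simp add: bil_def)
  then show ?thesis using i S' by (intro bexI[of _ "S' *\<^sub>v unit_vec n i"]) auto
qed

text \<open>Adding c x to \<open>v\<close> leaves \<open>B x v\<close> unchanged. As
  \<open>x\<close> is isotropic, B(v + c x, v + c x) = B(v,v) + 2 c B(x,v) is linear in c with a
  unit as leading coefficient, so it has a root.\<close>

lemma ex_isotropic_neighbour:
  assumes x: "x \<in> isotropic"
  shows "\<exists>w\<in>isotropic. B x w dvd 1"
proof -
  have xc: "x \<in> carrier_vec n" using x by (rule isotropic_carrier)
  obtain v where v: "v \<in> carrier_vec n" "B x v dvd 1"
    using unimodular_imp_unit_B[of x] x by (auto simp: isotropic_def)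
  obtain t :: 'a where t: "2 * t = 1" using two_unit by (metis dvdE)
  obtain b where b: "B x v * b = 1" using v by (metis dvdE)
  \<comment> \<open>With \<open>t\<close> = 1/2 and \<open>b\<close> = 1/B(x,v) the coefficient is
    the root c = -B(v,v) / (2 B(x,v)).\<close>
  define w where "w = v + (- (t * b * B v v)) \<cdot>\<^sub>v x"
  have wc: "w \<in> carrier_vec n" using v xc by (simp add: w_def)
  have "B w w = B v v - (2 * t) * (B x v * b) * B v v"
    using v xc isotropic_null[OF x] B_sym[OF v(1) xc] by (simp add: w_def B_simps algebra_simps)
  then have "B w w = 0" using t b by simp
  moreover have "B x w = B x v"
    using v xc isotropic_null[OF x] by (simp add: w_def B_simps)
  ultimately show ?thesis
    using unit_B_imp_unimodular[OF wc xc] wc xc v B_sym[of w x]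
    by (intro bexI[of _ w]) (auto simp: isotropic_def)
qed

subsection \<open>The orthogonal group\<close>

text \<open>The form pulled back along \<open>T\<^sup>T\<close> has Gram matrix
  \<open>T * S * T\<^sup>T\<close>, and a bilinear form determines its Gram matrix.\<close>

lemma orthogonal_iff_isometry:
  assumes T: "T \<in> carrier_mat n n"
  shows "T * S * T\<^sup>T = S \<longleftrightarrow> isometry T\<^sup>T"
proof -
  have eq: "B (T\<^sup>T *\<^sub>v v) (T\<^sup>T *\<^sub>v w) = v \<bullet> ((T * S * T\<^sup>T) *\<^sub>v w)"
    if "v \<in> carrier_vec n" "w \<in> carrier_vec n" for v w
    using that T S transpose_vec_mult_scalar[OF T, of "S *\<^sub>v (T\<^sup>T *\<^sub>v w)" v]
    by (simp add: bil_def assoc_mult_mat_vec[of _ n n _ n])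
  show ?thesis
  proof
    assume "T * S * T\<^sup>T = S"
    then show "isometry T\<^sup>T" using eq T by (simp add: isometry_def bil_def)
  next
    assume "isometry T\<^sup>T"
    then show "T * S * T\<^sup>T = S"
      using eq T S by (intro mat_eqI_scalar_prod[of _ n n]) (auto simp: isometry_def bil_def)
  qed
qed

text \<open>\<open>orth_group\<close> for a general Gram matrix \<open>S\<close>; at
  \<open>S_mat \<nu> \<delta> \<Delta>\<close> the two agree by unfolding.
  \<open>isotropic_graph\<close> below relates to \<open>orth_graph\<close> in the same way.\<close>

definition isometry_group :: "'a mat monoid" where
  "isometry_group = \<lparr> carrier = {T \<in> carrier_mat n n. T * S * T\<^sup>T = S},
     monoid.mult = (*), one = 1\<^sub>m n \<rparr>"

lemma isometry_groupD:
  "T \<in> carrier isometry_group \<Longrightarrow> T \<in> carrier_mat n n"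
  "T \<in> carrier isometry_group \<Longrightarrow> T * S * T\<^sup>T = S"
  "T \<in> carrier isometry_group \<Longrightarrow> isometry T\<^sup>T"
  using orthogonal_iff_isometry by (auto simp: isometry_group_def)

lemma isometry_transpose_in_group: "isometry M \<Longrightarrow> M\<^sup>T \<in> carrier isometry_group"
  using orthogonal_iff_isometry[of "M\<^sup>T"] by (auto simp: isometry_group_def isometry_def)

lemma isometry_mult: "isometry M \<Longrightarrow> isometry N \<Longrightarrow> isometry (M * N)"
  by (auto simp: isometry_def assoc_mult_mat_vec[of _ n n _ n])

lemma group_isometry_group: "group isometry_group"
proof (rule groupI)
  fix T U assume T: "T \<in> carrier isometry_group" and U: "U \<in> carrier isometry_group"
  have "(U\<^sup>T * T\<^sup>T)\<^sup>T \<in> carrier isometry_group"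
    using isometry_groupD[OF T] isometry_groupD[OF U] by (intro isometry_transpose_in_group isometry_mult)
  then show "T \<otimes>\<^bsub>isometry_group\<^esub> U \<in> carrier isometry_group"
    using isometry_groupD(1)[OF T] isometry_groupD(1)[OF U]
    by (simp add: transpose_mult[of _ n n _ n] isometry_group_def)
next
  show "\<one>\<^bsub>isometry_group\<^esub> \<in> carrier isometry_group"
    using S by (simp add: isometry_group_def)
next
  fix T assume T: "T \<in> carrier isometry_group"
  note c = isometry_groupD[OF T]
  obtain S' where S': "S' \<in> carrier_mat n n" "S * S' = 1\<^sub>m n" using S_inv by blast
  \<comment> \<open>Multiplying \<open>T * S * T\<^sup>T = S\<close> by \<open>S'\<close> from the
    right shows that this is a right inverse of \<open>T\<close>; determinants make it
    two-sided.\<close>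
  define U where "U = S * (T\<^sup>T * S')"
  have U: "U \<in> carrier_mat n n" using c S S' by (simp add: U_def)
  have "T * U = (T * S * T\<^sup>T) * S'"
    using c(1) S S'(1) by (simp add: U_def assoc_mult_mat[of _ n n _ n _ n])
  then have TU: "T * U = 1\<^sub>m n" using c S' by simp
  have UT: "U * T = 1\<^sub>m n" by (rule right_inverse_mat_imp_left_inverse[OF c(1) U TU])
  then have UT': "T\<^sup>T * U\<^sup>T = 1\<^sub>m n" using c(1) U by (metis transpose_mult transpose_one)
  have "U * S * U\<^sup>T = U * (T * S * T\<^sup>T) * U\<^sup>T" using c by simp
  also have "\<dots> = (U * T) * S * (T\<^sup>T * U\<^sup>T)"
    using c(1) S U by (simp add: assoc_mult_mat[of _ n n _ n _ n])
  also have "\<dots> = S" using UT UT' S by simp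
  finally have "U \<in> carrier isometry_group" using U by (simp add: isometry_group_def)
  then show "\<exists>U\<in>carrier isometry_group. U \<otimes>\<^bsub>isometry_group\<^esub> T = \<one>\<^bsub>isometry_group\<^esub>"
    using UT by (auto simp: isometry_group_def)
qed (auto simp: isometry_group_def)

text \<open>Unimodularity survives because it is witnessed by a unit value of the form.\<close>

lemma isometry_isotropic:
  assumes M: "isometry M" and x: "x \<in> isotropic"
  shows "M *\<^sub>v x \<in> isotropic"
proof -
  have xc: "x \<in> carrier_vec n" using x by (rule isotropic_carrier)
  have Mc: "M \<in> carrier_mat n n" using M by (simp add: isometry_def)
  obtain v where v: "v \<in> carrier_vec n" "B x v dvd 1"
    using unimodular_imp_unit_B[of x] x by (auto simp: isotropic_def)
  then have "B (M *\<^sub>v x) (M *\<^sub>v v) dvd 1" using M xc by (simp add: isometry_def)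
  then have "M *\<^sub>v x \<in> unimodular_vecs n"
    using Mc xc v by (intro unit_B_imp_unimodular) auto
  then show ?thesis
    using M xc isotropic_null[OF x] by (simp add: isotropic_def isometry_def)
qed

subsection \<open>Transitivity\<close>

lemma ex_reflection:
  assumes x: "x \<in> isotropic" and y: "y \<in> isotropic" and xy: "B x y dvd 1"
  shows "\<exists>M. isometry M \<and> M *\<^sub>v x = y"
proof -
  note c = isotropic_carrier[OF x] isotropic_carrier[OF y]
  note null = isotropic_null[OF x] isotropic_null[OF y]
  obtain b where b: "B x y * b = 1" using xy by (metis dvdE)
  define d where "d = x - y"
  have d: "d \<in> carrier_vec n" using c by (simp add: d_def)
  have dd: "B d d = - 2 * B x y"
    using c null B_sym[of y x] by (simp add: d_def B_simps)
  \<comment> \<open>The reflection in \<open>d\<close> is v - (2 B(v,d) / B(d,d)) d. Since B(d,d) =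
    -2 B(x,y), it becomes v + (B(v,d) / B(x,y)) d, and \<open>b\<close> is 1/B(x,y).\<close>
  define M where "M = 1\<^sub>m n + outer_prod (b \<cdot>\<^sub>v d) (S *\<^sub>v d)"
  have Mc: "M \<in> carrier_mat n n" using d S by (simp add: M_def outer_prod_carrier)
  have M: "M *\<^sub>v v = v + (b * B v d) \<cdot>\<^sub>v d" if v: "v \<in> carrier_vec n" for v
    using v d S B_sym[OF v d] comm_scalar_prod[of "S *\<^sub>v d" n v]
    by (simp add: M_def add_mult_distrib_mat_vec[of _ n n] outer_prod_carrier
        outer_prod_mult_vec[of _ n _ n] smult_smult_assoc bil_def mult.commute)
  have "B (M *\<^sub>v v) (M *\<^sub>v w) = B v w" if v: "v \<in> carrier_vec n" and w: "w \<in> carrier_vec n" for v w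
  proof -
    have "B (M *\<^sub>v v) (M *\<^sub>v w) = B v w + 2 * (b * B v d * B w d) + b * b * B v d * B w d * B d d"
      using v w d B_sym[OF w d] by (simp add: M B_simps algebra_simps)
    also have "\<dots> = B v w + 2 * (b * B v d * B w d) - 2 * (b * B v d * B w d) * (B x y * b)"
      by (simp add: dd algebra_simps)
    finally show ?thesis using b by simp
  qed
  then have "isometry M" using Mc by (simp add: isometry_def)
  moreover have "B x d = - B x y" using c null by (simp add: d_def B_simps)
  then have "M *\<^sub>v x = x + (- 1) \<cdot>\<^sub>v d" using M[OF c(1)] b by (simp add: mult.commute)
  then have "M *\<^sub>v x = y" using c by (intro eq_vecI) (auto simp: d_def)
  ultimately show ?thesis by blast
qed

lemma ex_eichler_transformation:
  assumes x: "x \<in> isotropic" and y: "y \<in> isotropic" and y': "y' \<in> isotropic"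
    and xy: "B x y = 1" and xy': "B x y' = 1"
  shows "\<exists>M. isometry M \<and> M *\<^sub>v x = x \<and> M *\<^sub>v y = y'"
proof -
  note c = isotropic_carrier[OF x] isotropic_carrier[OF y] isotropic_carrier[OF y']
  note null = isotropic_null[OF x] isotropic_null[OF y] isotropic_null[OF y']
  define u where "u = y' - y"
  \<comment> \<open>This is B(u,u)/2: as \<open>y\<close> and \<open>y'\<close> are isotropic, B(y'
    - y, y' - y) = -2 B(y,y').\<close>
  define q where "q = - B y y'"
  have u: "u \<in> carrier_vec n" using c by (simp add: u_def)
  have uu: "B u u = 2 * q"
    using c null B_sym[of y' y] by (simp add: u_def q_def B_simps)
  have xu: "B x u = 0" using c xy xy' by (simp add: u_def B_simps)
  then have ux: "B u x = 0" using B_sym[OF c(1) u] by simp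
  \<comment> \<open>The Eichler formula sorted by linear functionals: B(v,x) multiplies u - q x, and
    B(v,u) multiplies -x.\<close>
  define M where "M = 1\<^sub>m n + (outer_prod (u - q \<cdot>\<^sub>v x) (S *\<^sub>v x) + outer_prod (- x) (S *\<^sub>v u))"
  have Mc: "M \<in> carrier_mat n n" using u c S by (simp add: M_def outer_prod_carrier)
  have M: "M *\<^sub>v v = v + (B v x \<cdot>\<^sub>v u - (B v u + q * B v x) \<cdot>\<^sub>v x)" if v: "v \<in> carrier_vec n" for v
  proof -
    have "M *\<^sub>v v = v + (B v x \<cdot>\<^sub>v (u - q \<cdot>\<^sub>v x) + B v u \<cdot>\<^sub>v (- x))"
      using v u c S comm_scalar_prod[of "S *\<^sub>v u" n v] comm_scalar_prod[of "S *\<^sub>v x" n v]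
      by (simp add: M_def add_mult_distrib_mat_vec[of _ n n] outer_prod_carrier
          outer_prod_mult_vec[of _ n _ n] bil_def)
    also have "\<dots> = v + (B v x \<cdot>\<^sub>v u - (B v u + q * B v x) \<cdot>\<^sub>v x)"
      using v u c by (intro eq_vecI) (auto simp: algebra_simps)
    finally show ?thesis .
  qed
  \<comment> \<open>In the expansion the products B(v,u) B(w,x) and B(v,x) B(w,u) each occur with
    both signs, and B(v,x) B(w,x) has the coefficient B(u,u) - 2q = 0.\<close>
  have "B (M *\<^sub>v v) (M *\<^sub>v w) = B v w" if v: "v \<in> carrier_vec n" and w: "w \<in> carrier_vec n" for v w
    using v w u c B_sym[OF u w] B_sym[OF c(1) w] null xu ux uu
    by (simp add: M B_simps algebra_simps)
  then have "isometry M" using Mc by (simp add: isometry_def)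
  moreover have "M *\<^sub>v x = x"
    using M[OF c(1)] null xu c u by (simp add: left_zero_vec) (intro eq_vecI, auto)
  moreover have "M *\<^sub>v y = y'"
  proof -
    \<comment> \<open>Now B(y,u) + q B(y,x) = 0, so the multiple of \<open>x\<close> vanishes and
      \<open>y\<close> goes to y + u = y'.\<close>
    have "B y u = - q" using c null by (simp add: u_def q_def B_simps)
    moreover have "B y x = 1" using B_sym c xy by simp
    ultimately have "M *\<^sub>v y = y + (1 \<cdot>\<^sub>v u - 0 \<cdot>\<^sub>v x)" using M[OF c(2)] by simp
    then show ?thesis using c by (intro eq_vecI) (auto simp: u_def)
  qed
  ultimately show ?thesis by blast
qed

lemma ex_isometry_path:
  assumes "\<exists>M. isometry M \<and> M *\<^sub>v x = y" "\<exists>M. isometry M \<and> M *\<^sub>v y = w" "x \<in> carrier_vec n"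
  shows "\<exists>M. isometry M \<and> M *\<^sub>v x = w"
proof -
  obtain M N where MN: "isometry M" "M *\<^sub>v x = y" "isometry N" "N *\<^sub>v y = w" using assms by blast
  then have "(N * M) *\<^sub>v x = w"
    using assms(3) by (auto simp: isometry_def assoc_mult_mat_vec[of _ n n _ n])
  then show ?thesis using isometry_mult MN by blast
qed

text \<open>Take a neighbour \<open>w\<close> of \<open>x\<close> and a neighbour \<open>w'\<close>
  of \<open>y\<close>. If a vector of {x, w} and a vector of {y, w'} pair to a unit, a path of at
  most three edges joins \<open>x\<close> to \<open>y\<close>, and every edge is realised by a
  reflection. Otherwise a common neighbour of \<open>x\<close> and \<open>y\<close> is built from
  \<open>w\<close> and \<open>w'\<close>.\<close>

lemma ex_isometry:
  assumes x: "x \<in> isotropic" and y: "y \<in> isotropic"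
  shows "\<exists>M. isometry M \<and> M *\<^sub>v x = y"
proof -
  have two_step: "\<exists>M. isometry M \<and> M *\<^sub>v a = c"
    if "a \<in> isotropic" "b \<in> isotropic" "c \<in> isotropic" "B a b dvd 1" "B b c dvd 1" for a b c
    using that by (intro ex_isometry_path[of a b c] ex_reflection isotropic_carrier)
  obtain w where w: "w \<in> isotropic" and xw: "B x w dvd 1" using ex_isotropic_neighbour[OF x] by blast
  obtain w' where w': "w' \<in> isotropic" and yw': "B y w' dvd 1" using ex_isotropic_neighbour[OF y] by blast
  note c = isotropic_carrier[OF x] isotropic_carrier[OF y] isotropic_carrier[OF w] isotropic_carrier[OF w']
  note null = isotropic_null[OF x] isotropic_null[OF y] isotropic_null[OF w] isotropic_null[OF w']
  note sym = B_sym[OF c(2,1)] B_sym[OF c(3,1)] B_sym[OF c(4,1)] B_sym[OF c(3,2)] B_sym[OF c(4,2)] B_sym[OF c(4,3)]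
  consider "B x y dvd 1" | "B y w dvd 1" | "B x w' dvd 1" | "B w w' dvd 1"
    | "\<not> B x y dvd 1" "\<not> B y w dvd 1" "\<not> B x w' dvd 1" "\<not> B w w' dvd 1" by blast
  then show ?thesis
  proof cases
    case 1
    with x y show ?thesis by (rule ex_reflection)
  next
    case 2
    then show ?thesis using two_step[OF x w y] xw sym by simp
  next
    case 3
    then show ?thesis using two_step[OF x w' y] yw' sym by simp
  next
    case 4
    have "\<exists>M. isometry M \<and> M *\<^sub>v w = y" using two_step[OF w w' y] 4 yw' sym by simp
    then show ?thesis using ex_reflection[OF x w xw] c by (intro ex_isometry_path[of x w y])
  next
    case 5
    \<comment> \<open>\<open>w + w'\<close> pairs to units with both \<open>x\<close> and \<open>y\<close>; a multiple of \<open>x\<close> makes it isotropic.\<close>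
    have nonunit_minus: "\<not> - a dvd 1" if "\<not> a dvd 1" for a :: 'a
      using that by simp
    have unit_add: "a + b dvd 1" if "a dvd 1" "\<not> b dvd 1" for a b :: 'a
      using nonunit_add[of "a + b" "- b"] nonunit_minus[of b] that by auto
    have e: "B x w + B x w' dvd 1" using unit_add xw 5 by simp
    then obtain r where r: "(B x w + B x w') * r = 1" by (metis dvdE)
    \<comment> \<open>By isotropy of \<open>w\<close>, \<open>w'\<close> and \<open>x\<close>,
      B(u,u) = 2 (B(w,w') + k (B(x,w) + B(x,w'))) is linear in \<open>k\<close>; this is its
      root.\<close>
    define k where "k = - (B w w' * r)"
    define u where "u = w + w' + k \<cdot>\<^sub>v x"
    have uc: "u \<in> carrier_vec n" using c by (simp add: u_def)
    have "B u u = 2 * B w w' - 2 * B w w' * ((B x w + B x w') * r)"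
      using c null sym by (simp add: u_def k_def B_simps algebra_simps)
    then have "B u u = 0" using r by simp
    moreover have xu: "B x u dvd 1"
      using e c null by (simp add: u_def B_simps)
    \<comment> \<open>Of these terms only \<open>B y w'\<close> is a unit, and in a local ring
      adding nonunits keeps it one.\<close>
    moreover have "B u y = B y w' + (B y w + k * B x y)"
      using c null sym by (simp add: u_def B_simps algebra_simps)
    moreover have "\<not> k * B x y dvd 1" using 5 by (simp add: is_unit_mult_iff)
    then have "\<not> B y w + k * B x y dvd 1" using 5 nonunit_add by blast
    ultimately have "B u y dvd 1" using unit_add[OF yw'] by simp
    moreover have "u \<in> isotropic"
      using \<open>B u u = 0\<close> unit_B_imp_unimodular[OF uc c(1)] xu B_sym[OF uc c(1)]
      by (simp add: isotropic_def)
    ultimately show ?thesis using two_step[OF x _ y] xu by blast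
  qed
qed

text \<open>Unit multiples have the same class, so \<open>b\<close> and \<open>d\<close> can be
  rescaled to reach the value 1 that the Eichler transformation requires. One isometry moves
  \<open>a\<close> to \<open>c\<close>; a second one fixes \<open>c\<close> and moves the image of
  the rescaled \<open>b\<close> to the rescaled \<open>d\<close>.\<close>

lemma ex_isometry_arc:
  assumes a: "a \<in> isotropic" and b: "b \<in> isotropic" and ab: "B a b dvd 1"
    and c: "c \<in> isotropic" and d: "d \<in> isotropic" and cd: "B c d dvd 1"
  shows "\<exists>M. isometry M \<and> unit_class (M *\<^sub>v a) = unit_class c \<and> unit_class (M *\<^sub>v b) = unit_class d"
proof -
  have scale: "\<exists>t. t dvd 1 \<and> t \<cdot>\<^sub>v w \<in> isotropic \<and> B v (t \<cdot>\<^sub>v w) = 1"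
    if v: "v \<in> isotropic" and w: "w \<in> isotropic" and vw: "B v w dvd 1" for v w
  proof -
    obtain t where t: "B v w * t = 1" using vw by (metis dvdE)
    then have tu: "t dvd 1" by (metis dvd_triv_right)
    note vc = isotropic_carrier[OF v] isotropic_carrier[OF w]
    have 1: "B v (t \<cdot>\<^sub>v w) = 1" using t vc by (simp add: B_simps mult.commute)
    then have "B (t \<cdot>\<^sub>v w) v dvd 1" using B_sym[of "t \<cdot>\<^sub>v w" v] vc by simp
    then have "t \<cdot>\<^sub>v w \<in> unimodular_vecs n" using vc by (intro unit_B_imp_unimodular[of _ v]) auto
    then show ?thesis using 1 tu vc isotropic_null[OF w] by (auto simp: isotropic_def B_simps)
  qed
  obtain t where t: "t dvd 1" "t \<cdot>\<^sub>v b \<in> isotropic" "B a (t \<cdot>\<^sub>v b) = 1" using scale[OF a b ab] by blast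
  obtain r where r: "r dvd 1" "r \<cdot>\<^sub>v d \<in> isotropic" "B c (r \<cdot>\<^sub>v d) = 1" using scale[OF c d cd] by blast
  obtain M where M: "isometry M" "M *\<^sub>v a = c" using ex_isometry[OF a c] by blast
  have "B c (M *\<^sub>v (t \<cdot>\<^sub>v b)) = 1"
    using M t isotropic_carrier[OF a] isotropic_carrier[OF t(2)] by (auto simp: isometry_def)
  then obtain N where N: "isometry N" "N *\<^sub>v c = c" "N *\<^sub>v (M *\<^sub>v (t \<cdot>\<^sub>v b)) = r \<cdot>\<^sub>v d"
    using ex_eichler_transformation[OF c isometry_isotropic[OF M(1) t(2)] r(2)] r(3) by blast
  have car: "M \<in> carrier_mat n n" "N \<in> carrier_mat n n" using M N by (auto simp: isometry_def)
  have bc: "b \<in> carrier_vec n" using b by (rule isotropic_carrier)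
  have "(N * M) *\<^sub>v a = c"
    using car isotropic_carrier[OF a] M N by (simp add: assoc_mult_mat_vec[of _ n n _ n])
  moreover have "unit_class ((N * M) *\<^sub>v b) = unit_class d"
  proof -
    have "t \<cdot>\<^sub>v ((N * M) *\<^sub>v b) = (N * M) *\<^sub>v (t \<cdot>\<^sub>v b)"
      using car bc by (simp add: mult_mat_vec_smult[of _ n n])
    also have "\<dots> = r \<cdot>\<^sub>v d"
      using car bc N(3) by (simp add: assoc_mult_mat_vec[of _ n n _ n])
    finally show ?thesis using unit_class_smult t(1) r(1) by metis
  qed
  ultimately show ?thesis using isometry_mult[OF N(1) M(1)] by auto
qed

subsection \<open>The graph\<close>

definition isotropic_graph :: "'a vec set pair_pre_digraph" where
  "isotropic_graph = \<lparr> pverts = unit_class ` isotropic,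
     parcs = {(unit_class \<alpha>, unit_class \<beta>) | \<alpha> \<beta>. \<alpha> \<in> isotropic \<and> \<beta> \<in> isotropic \<and> B \<alpha> \<beta> dvd 1} \<rparr>"

lemma vertex_act_class:
  assumes "T \<in> carrier isometry_group" "x \<in> isotropic"
  shows "vertex_act T (unit_class x) = unit_class (T\<^sup>T *\<^sub>v x)"
  using vertex_act_unit_class[of T n x] isometry_groupD(1)[OF assms(1)] isotropic_carrier[OF assms(2)]
  by simp

lemma vertex_act_verts:
  assumes T: "T \<in> carrier isometry_group" and X: "X \<in> pverts isotropic_graph"
  shows "vertex_act T X \<in> pverts isotropic_graph"
  using X vertex_act_class[OF T] isometry_isotropic[OF isometry_groupD(3)[OF T]]
  by (auto simp: isotropic_graph_def)

lemma vertex_act_arcs: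
  assumes T: "T \<in> carrier isometry_group" and XY: "(X, Y) \<in> parcs isotropic_graph"
  shows "(vertex_act T X, vertex_act T Y) \<in> parcs isotropic_graph"
proof -
  note i = isometry_groupD(3)[OF T]
  obtain x y where xy: "X = unit_class x" "Y = unit_class y" "x \<in> isotropic" "y \<in> isotropic" "B x y dvd 1"
    using XY by (auto simp: isotropic_graph_def)
  then have "B (T\<^sup>T *\<^sub>v x) (T\<^sup>T *\<^sub>v y) dvd 1"
    using i isotropic_carrier by (simp add: isometry_def)
  moreover have "T\<^sup>T *\<^sub>v x \<in> isotropic" "T\<^sup>T *\<^sub>v y \<in> isotropic"
    using xy isometry_isotropic[OF i] by simp_all
  ultimately have "(unit_class (T\<^sup>T *\<^sub>v x), unit_class (T\<^sup>T *\<^sub>v y)) \<in> parcs isotropic_graph"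
    unfolding isotropic_graph_def by auto
  then show ?thesis using xy vertex_act_class[OF T] by simp
qed

lemma vertex_act_one:
  assumes "X \<in> pverts isotropic_graph"
  shows "vertex_act \<one>\<^bsub>isometry_group\<^esub> X = X"
proof -
  obtain x where x: "X = unit_class x" "x \<in> carrier_vec n"
    using assms isotropic_carrier by (auto simp: isotropic_graph_def)
  then show ?thesis
    using vertex_act_unit_class[of "1\<^sub>m n" n x] by (simp add: isometry_group_def)
qed

text \<open>Transposition reverses products, which makes this an action from the right.\<close>

lemma vertex_act_mult:
  assumes T: "T \<in> carrier isometry_group" and U: "U \<in> carrier isometry_group"
    and X: "X \<in> pverts isotropic_graph"
  shows "vertex_act (T \<otimes>\<^bsub>isometry_group\<^esub> U) X = vertex_act U (vertex_act T X)"
proof -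
  interpret group isometry_group by (rule group_isometry_group)
  note c = isometry_groupD(1)[OF T] isometry_groupD(1)[OF U]
  obtain x where x: "X = unit_class x" "x \<in> isotropic" using X by (auto simp: isotropic_graph_def)
  have "(T \<otimes>\<^bsub>isometry_group\<^esub> U)\<^sup>T *\<^sub>v x = U\<^sup>T *\<^sub>v (T\<^sup>T *\<^sub>v x)"
    using c isotropic_carrier[OF x(2)]
    by (simp add: isometry_group_def transpose_mult[of _ n n _ n] assoc_mult_mat_vec[of _ n n _ n])
  then show ?thesis
    using x vertex_act_class[OF m_closed[OF T U] x(2)] vertex_act_class[OF T x(2)]
      vertex_act_class[OF U isometry_isotropic[OF isometry_groupD(3)[OF T] x(2)]] by simp
qed

lemma arcs_subset_verts: "(X, Y) \<in> parcs isotropic_graph \<Longrightarrow> X \<in> pverts isotropic_graph \<and> Y \<in> pverts isotropic_graph"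
  by (auto simp: isotropic_graph_def)

lemma ex_vertex_act_arc:
  assumes "(X, Y) \<in> parcs isotropic_graph" "(X', Y') \<in> parcs isotropic_graph"
  shows "\<exists>T\<in>carrier isometry_group. vertex_act T X = X' \<and> vertex_act T Y = Y'"
proof -
  obtain a b where ab: "X = unit_class a" "Y = unit_class b" "a \<in> isotropic" "b \<in> isotropic" "B a b dvd 1"
    using assms(1) by (auto simp: isotropic_graph_def)
  obtain c d where cd: "X' = unit_class c" "Y' = unit_class d" "c \<in> isotropic" "d \<in> isotropic" "B c d dvd 1"
    using assms(2) by (auto simp: isotropic_graph_def)
  obtain M where "isometry M" "unit_class (M *\<^sub>v a) = unit_class c" "unit_class (M *\<^sub>v b) = unit_class d"
    using ex_isometry_arc ab cd by metis
  then show ?thesis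
    using ab cd isometry_transpose_in_group[of M] vertex_act_class[of "M\<^sup>T"]
    by (intro bexI[of _ "M\<^sup>T"]) auto
qed

theorem vertex_transitive:
  "acts_transitively_right isometry_group vertex_act (pverts isotropic_graph)"
proof (rule acts_transitively_rightI)
  fix X Y assume "X \<in> pverts isotropic_graph" "Y \<in> pverts isotropic_graph"
  then obtain x y where xy: "X = unit_class x" "Y = unit_class y" "x \<in> isotropic" "y \<in> isotropic"
    by (auto simp: isotropic_graph_def)
  obtain M where "isometry M" "M *\<^sub>v x = y" using ex_isometry xy by blast
  then show "\<exists>T\<in>carrier isometry_group. vertex_act T X = Y"
    using xy isometry_transpose_in_group[of M] vertex_act_class[of "M\<^sup>T"]
    by (intro bexI[of _ "M\<^sup>T"]) auto
qed (use group_isometry_group vertex_act_verts vertex_act_one vertex_act_mult in auto)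

theorem group_arc_transitive:
  "acts_transitively_right isometry_group (\<lambda>T. map_prod (vertex_act T) (vertex_act T)) (parcs isotropic_graph)"
proof (rule acts_transitively_rightI)
  show "group isometry_group" by (rule group_isometry_group)
next
  fix E F assume "E \<in> parcs isotropic_graph" "F \<in> parcs isotropic_graph"
  then show "\<exists>T\<in>carrier isometry_group. map_prod (vertex_act T) (vertex_act T) E = F"
    using ex_vertex_act_arc[of "fst E" "snd E" "fst F" "snd F"]
    by (cases E, cases F) auto
next
  fix T E assume "T \<in> carrier isometry_group" "E \<in> parcs isotropic_graph"
  then show "map_prod (vertex_act T) (vertex_act T) E \<in> parcs isotropic_graph"
    using vertex_act_arcs by (cases E) auto
next
  fix E assume "E \<in> parcs isotropic_graph"
  then show "map_prod (vertex_act \<one>\<^bsub>isometry_group\<^esub>) (vertex_act \<one>\<^bsub>isometry_group\<^esub>) E = E"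
    using arcs_subset_verts vertex_act_one by (cases E) auto
next
  fix T U E assume "T \<in> carrier isometry_group" "U \<in> carrier isometry_group" "E \<in> parcs isotropic_graph"
  then show "map_prod (vertex_act (T \<otimes>\<^bsub>isometry_group\<^esub> U)) (vertex_act (T \<otimes>\<^bsub>isometry_group\<^esub> U)) E =
      map_prod (vertex_act U) (vertex_act U) (map_prod (vertex_act T) (vertex_act T) E)"
    using arcs_subset_verts vertex_act_mult by (cases E) auto
qed

text \<open>The inverse matrix acts as the inverse permutation and preserves arcs as well, so
  non-adjacent vertices stay non-adjacent.\<close>

lemma vertex_act_automorphism:
  assumes T: "T \<in> carrier isometry_group"
  shows "graph_automorphism isotropic_graph (vertex_act T)"
proof -
  interpret group isometry_group by (rule group_isometry_group)
  let ?U = "inv\<^bsub>isometry_group\<^esub> T"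
  have U: "?U \<in> carrier isometry_group" using T by simp
  have UT: "vertex_act ?U (vertex_act T X) = X" if "X \<in> pverts isotropic_graph" for X
    using vertex_act_mult[OF T U that] vertex_act_one[OF that] T by simp
  have TU: "vertex_act T (vertex_act ?U X) = X" if "X \<in> pverts isotropic_graph" for X
    using vertex_act_mult[OF U T that] vertex_act_one[OF that] T by simp
  have "bij_betw (vertex_act T) (pverts isotropic_graph) (pverts isotropic_graph)"
    using UT TU vertex_act_verts[OF T] vertex_act_verts[OF U]
    by (intro bij_betw_byWitness[where f' = "vertex_act ?U"]) auto
  then show ?thesis
    unfolding graph_automorphism_def using vertex_act_arcs[OF T] vertex_act_arcs[OF U] UT by metis
qed

theorem arc_transitive_isotropic_graph: "arc_transitive isotropic_graph"
proof -
  have "\<exists>f. graph_automorphism isotropic_graph f \<and> f a = c \<and> f b = d"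
    if ab: "(a, b) \<in> parcs isotropic_graph" and cd: "(c, d) \<in> parcs isotropic_graph" for a b c d
  proof -
    obtain T where "T \<in> carrier isometry_group" "vertex_act T a = c" "vertex_act T b = d"
      using ex_vertex_act_arc[OF ab cd] by blast
    then show ?thesis using vertex_act_automorphism[of T] by (intro exI[of _ "vertex_act T"]) simp
  qed
  then show ?thesis unfolding arc_transitive_def by auto
qed

end

section \<open>Galois rings of odd characteristic\<close>

lemma galois_ring_nonunit_add:
  assumes R: "galois_ring TYPE('a::comm_ring_1) p s m"
    and a: "\<not> (a::'a) dvd 1" and b: "\<not> b dvd 1"
  shows "\<not> a + b dvd 1"
proof -
  note nu = galois_ring_nonunits[OF R]
  have "a \<in> range (\<lambda>r. of_nat p * r)" "b \<in> range (\<lambda>r. of_nat p * r)"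
    using a b unfolding nu[symmetric] by simp_all
  then obtain c d where "a = of_nat p * c" "b = of_nat p * d" by auto
  then have "a + b = of_nat p * (c + d)" by (simp add: algebra_simps)
  then have "a + b \<in> range (\<lambda>r. of_nat p * r)" by simp
  then show ?thesis unfolding nu[symmetric] by simp
qed

text \<open>Were 2 a nonunit, it would lie in pR; writing p = 2k + 1, so would 1 = p - 2k.\<close>

lemma galois_ring_two_unit:
  assumes R: "galois_ring TYPE('a::comm_ring_1) p s m" and p: "odd p"
  shows "(2::'a) dvd 1"
proof (rule ccontr)
  note nu = galois_ring_nonunits[OF R]
  assume "\<not> (2::'a) dvd 1"
  then obtain r :: 'a where r: "2 = of_nat p * r" using nu by blast
  obtain k where k: "p = 2 * k + 1" using p by (rule oddE)
  have "(1::'a) = of_nat p - of_nat k * 2" by (simp add: k)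
  also have "\<dots> = of_nat p * (1 - of_nat k * r)" by (subst r) (simp add: algebra_simps)
  finally have "\<not> (1::'a) dvd 1" using nu by blast
  then show False by simp
qed

section \<open>Gram matrices of the orthogonal graphs\<close>

lemma Delta_blocks_inverse:
  assumes z: "z dvd (1::'a::comm_ring_1)" and D: "\<Delta> \<in> Delta_blocks z \<delta>"
  shows "\<Delta> \<in> carrier_mat \<delta> \<delta>" "\<Delta>\<^sup>T = \<Delta>" "\<exists>\<Delta>'\<in>carrier_mat \<delta> \<delta>. \<Delta> * \<Delta>' = 1\<^sub>m \<delta>"
proof -
  obtain y where y: "z * y = 1" using z by (metis dvdE)
  consider "\<delta> = 0" "\<Delta> = 0\<^sub>m 0 0" | "\<delta> = 1" "\<Delta> = mat_of_rows_list 1 [[1]]"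
    | "\<delta> = 1" "\<Delta> = mat_of_rows_list 1 [[z]]" | "\<delta> = 2" "\<Delta> = mat_of_rows_list 2 [[1, 0], [0, - z]]"
    using D by (auto simp: Delta_blocks_def split: if_splits)
  note cs = this
  show "\<Delta> \<in> carrier_mat \<delta> \<delta>"
    by (cases rule: cs) (auto simp: mat_of_rows_list_def)
  show "\<Delta>\<^sup>T = \<Delta>"
    by (cases rule: cs) (auto intro!: eq_matI simp: mat_of_rows_list_def numeral_2_eq_2 less_Suc_eq)
  show "\<exists>\<Delta>'\<in>carrier_mat \<delta> \<delta>. \<Delta> * \<Delta>' = 1\<^sub>m \<delta>"
  proof (cases rule: cs)
    case 1
    then show ?thesis by (intro bexI[of _ "0\<^sub>m 0 0"]) auto
  next
    case 2
    then show ?thesis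
      by (intro bexI[of _ "mat_of_rows_list 1 [[1]]"])
        (auto intro!: eq_matI simp: mat_of_rows_list_def scalar_prod_def)
  next
    case 3
    then show ?thesis using y
      by (intro bexI[of _ "mat_of_rows_list 1 [[y]]"])
        (auto intro!: eq_matI simp: mat_of_rows_list_def scalar_prod_def)
  next
    case 4
    then show ?thesis using y
      by (intro bexI[of _ "mat_of_rows_list 2 [[1, 0], [0, - y]]"])
        (auto intro!: eq_matI simp: mat_of_rows_list_def scalar_prod_def numeral_2_eq_2 less_Suc_eq)
  qed
qed

lemma S_mat_carrier:
  "\<Delta> \<in> carrier_mat \<delta> \<delta> \<Longrightarrow> S_mat \<nu> \<delta> \<Delta> \<in> carrier_mat (2 * \<nu> + \<delta>) (2 * \<nu> + \<delta>)"
  by (auto simp: S_mat_def)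

lemma S_mat_transpose:
  assumes "\<Delta> \<in> carrier_mat \<delta> \<delta>"
  shows "(S_mat \<nu> \<delta> \<Delta>)\<^sup>T = S_mat \<nu> \<delta> \<Delta>\<^sup>T"
proof -
  let ?H = "four_block_mat (0\<^sub>m \<nu> \<nu>) (1\<^sub>m \<nu>) (1\<^sub>m \<nu>) (0\<^sub>m \<nu> \<nu>) :: 'a mat"
  have H: "?H \<in> carrier_mat (2 * \<nu>) (2 * \<nu>)" by (auto simp: mult_2)
  have "?H\<^sup>T = ?H" by (subst transpose_four_block_mat[of _ \<nu> \<nu> _ \<nu> _ \<nu>]) auto
  then show ?thesis
    unfolding S_mat_def using assms H
    by (subst transpose_four_block_mat[of _ "2 * \<nu>" "2 * \<nu>" _ \<delta> _ \<delta>]) auto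
qed

text \<open>The hyperbolic block squares to the identity, so inverting the block-diagonal
  \<open>S_mat\<close> amounts to inverting \<open>\<Delta>\<close>.\<close>

lemma S_mat_mult:
  assumes "\<Delta> \<in> carrier_mat \<delta> \<delta>" "\<Delta>' \<in> carrier_mat \<delta> \<delta>" "\<Delta> * \<Delta>' = 1\<^sub>m \<delta>"
  shows "S_mat \<nu> \<delta> \<Delta> * S_mat \<nu> \<delta> \<Delta>' = 1\<^sub>m (2 * \<nu> + \<delta>)"
proof -
  let ?H = "four_block_mat (0\<^sub>m \<nu> \<nu>) (1\<^sub>m \<nu>) (1\<^sub>m \<nu>) (0\<^sub>m \<nu> \<nu>) :: 'a mat"
  have H: "?H \<in> carrier_mat (2 * \<nu>) (2 * \<nu>)" by (auto simp: mult_2)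
  have "?H * ?H = 1\<^sub>m (2 * \<nu>)"
    by (subst mult_four_block_mat[of _ \<nu> \<nu> _ \<nu> _ \<nu> _ _ \<nu> _ \<nu>]) (auto simp: mult_2)
  then show ?thesis
    unfolding S_mat_def using assms H
    by (subst mult_four_block_mat[of _ "2 * \<nu>" "2 * \<nu>" _ \<delta> _ \<delta> _ _ "2 * \<nu>" _ \<delta>])
      (auto simp flip: mult_2)
qed

theorem theorem2p2:
  fixes p s m \<nu> \<delta> :: nat and z :: "'a::comm_ring_1" and \<Delta> :: "'a mat"
  assumes "prime p" and "odd p" and "s \<ge> 2" and "m \<ge> 1"
    and "galois_ring TYPE('a) p s m"
    and "z dvd 1" and "\<nexists>y. z = y\<^sup>2"
    and "\<nu> \<ge> 1" and "\<delta> \<in> {0, 1, 2}" and "\<Delta> \<in> Delta_blocks z \<delta>"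
  shows "arc_transitive (orth_graph \<nu> \<delta> \<Delta>) \<and>
    acts_transitively_right (orth_group \<nu> \<delta> \<Delta>) vertex_act (pverts (orth_graph \<nu> \<delta> \<Delta>)) \<and>
    acts_transitively_right (orth_group \<nu> \<delta> \<Delta>) (\<lambda>T. map_prod (vertex_act T) (vertex_act T))
      (parcs (orth_graph \<nu> \<delta> \<Delta>))"
proof -
  note D = Delta_blocks_inverse[OF assms(6) assms(10)]
  obtain \<Delta>' where D': "\<Delta>' \<in> carrier_mat \<delta> \<delta>" "\<Delta> * \<Delta>' = 1\<^sub>m \<delta>" using D(3) by blast
  \<comment> \<open>Locality holds because the nonunits are the ideal pR; nondegeneracy comes from
    \<open>\<Delta>'\<close>, which exists because \<open>z\<close> is a unit.\<close>
  interpret local_bilinear_space "2 * \<nu> + \<delta>" "S_mat \<nu> \<delta> \<Delta>"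
  proof
    show "S_mat \<nu> \<delta> \<Delta> \<in> carrier_mat (2 * \<nu> + \<delta>) (2 * \<nu> + \<delta>)" using D by (intro S_mat_carrier)
    show "(S_mat \<nu> \<delta> \<Delta>)\<^sup>T = S_mat \<nu> \<delta> \<Delta>" using S_mat_transpose[OF D(1)] D(2) by simp
    show "\<exists>S'\<in>carrier_mat (2 * \<nu> + \<delta>) (2 * \<nu> + \<delta>). S_mat \<nu> \<delta> \<Delta> * S' = 1\<^sub>m (2 * \<nu> + \<delta>)"
      using S_mat_mult[OF D(1) D'] S_mat_carrier[OF D'(1)] by blast
    show "(2::'a) dvd 1" using galois_ring_two_unit assms by blast
    show "\<not> a + b dvd 1" if "\<not> a dvd 1" "\<not> b dvd 1" for a b :: 'a
      using galois_ring_nonunit_add[OF assms(5) that] .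
  qed
  have "orth_graph \<nu> \<delta> \<Delta> = isotropic_graph"
    by (simp add: orth_graph_def isotropic_graph_def isotropic_def Let_def)
  moreover have "orth_group \<nu> \<delta> \<Delta> = isometry_group"
    by (simp add: orth_group_def isometry_group_def)
  ultimately show ?thesis
    using arc_transitive_isotropic_graph vertex_transitive group_arc_transitive by simp
qed

end
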